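(* Let $\mathcal H$ be a real Hilbert space, $C\subseteq\mathcal H$ nonempty, closed and convex, and $F:\mathcal H\to\mathcal H$. Assume that $SOL(C,F)\neq\emptyset$, that $F$ is monotone on $\mathcal H$ ($\langle F(x)-F(y),x-y\rangle\ge 0$ for all $x,y\in\mathcal H$), and that $F$ is Lipschitz continuous on $\mathcal H$ with some constant $L>0$. Assume that the sequence $\{v^k\}_{k=0}^\infty\subset\mathcal H$ is bounded and that the positive scalars $\{\lambda_k\}_{k=0}^\infty$ satisfy $\sum_{k=0}^\infty\lambda_k<+\infty$. Then any sequence $\{x^k\}_{k=0}^\infty$ generated by the PC-algorithm II with bounded perturbations (described in the context) converges weakly to a point of $SOL(C,F)$, i.e. to a solution of the variational inequality problem.
   Context: The variational inequality problem is: find $x^*\in C$ with $\langle F(x^* ),x-x^*\rangle\ge 0$ for all $x\in C$; its solution set is $SOL(C,F)$. $P_C$ denotes the metric projection onto $C$. PC-algorithm II with bounded perturbations: fix $\nu\in(0,1)$ and $\gamma\in(0,2)$. Take $x^0\in\mathcal H$ arbitrarily. Given $x^k\in\mathcal H$, set $$y^k=P_C\big((x^k+\lambda_kv^k)-\beta_kF(x^k+\lambda_kv^k)\big),$$ where $\beta_k>0$ is selected to satisfy $$\beta_k\|F(x^k+\lambda_kv^k)-F(y^k)\|\le\nu\|x^k+\lambda_kv^k-y^k\|.$$ Define $$d(x^k+\lambda_kv^k,y^k)=(x^k+\lambda_kv^k-y^k)-\beta_k\big(F(x^k+\lambda_kv^k)-F(y^k)\big),$$ $$\rho_k=\frac{\langle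 x^k+\lambda_kv^k-y^k,d(x^k+\lambda_kv^k,y^k)\rangle}{\|d(x^k+\lambda_kv^k,y^k)\|^2},\qquad x^{k+1}=P_C\big(x^k+\lambda_kv^k-\gamma\beta_k\rho_kF(y^k)\big).$$ It is understood that $d(x^k+\lambda_kv^k,y^k)\ne0$ for all $k$, so that $\rho_k$ is defined.
   Formalization: The formal theorem additionally assumes that the step sizes β_k are bounded below by a positive constant; without this the claim fails, e.g. F = id on the real line, v^k = 0, γ = 1, β_k = 1/(k+2)², where x^k = (k+2)/(k+1) tends to 1 although 0 is the only solution. *)

theory Defs
  imports "HOL-Analysis.Analysis"
begin

(* A real Hilbert space is a type of sort {real_inner, complete_space}. *)

definition VI_SOL :: "'a::real_inner set \<Rightarrow> ('a \<Rightarrow> 'a) \<Rightarrow> 'a set" where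
  "VI_SOL C F = {x \<in> C. \<forall>z\<in>C. inner (F x) (z - x) \<ge> 0}"

definition monotone_operator :: "('a::real_inner \<Rightarrow> 'a) \<Rightarrow> bool" where
  "monotone_operator F \<longleftrightarrow> (\<forall>x y. inner (F x - F y) (x - y) \<ge> 0)"

(* The body of the library's closest_point, whose sort heine_borel would exclude the
   infinite-dimensional Hilbert spaces. The choice is the unique nearest point when C is
   nonempty, closed and convex in a Hilbert space, and unspecified if none exists. *)
definition metric_proj :: "'a::real_inner set \<Rightarrow> 'a \<Rightarrow> 'a" where
  "metric_proj C a = (SOME p. p \<in> C \<and> (\<forall>z\<in>C. dist a p \<le> dist a z))"

(* Convergence in the weak topology of a Hilbert space, the coarsest topology making all
   functionals x \<mapsto> <x, z> continuous. *)
definition weakly_converges_to :: "(nat \<Rightarrow> 'a::real_inner) \<Rightarrow> 'a \<Rightarrow> bool" where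
  "weakly_converges_to x l \<longleftrightarrow> (\<forall>z. (\<lambda>k. inner (x k) z) \<longlonglongrightarrow> inner l z)"

definition pc_dir :: "('a::real_inner \<Rightarrow> 'a) \<Rightarrow> real \<Rightarrow> 'a \<Rightarrow> 'a \<Rightarrow> 'a" where
  "pc_dir F b w y = (w - y) - b *\<^sub>R (F w - F y)"

definition pc_rho :: "('a::real_inner \<Rightarrow> 'a) \<Rightarrow> real \<Rightarrow> 'a \<Rightarrow> 'a \<Rightarrow> real" where
  "pc_rho F b w y = inner (w - y) (pc_dir F b w y) / (norm (pc_dir F b w y))\<^sup>2"

(* x is a sequence generated by the algorithm with the step sizes \<beta>; the starting point x 0
   is unrestricted. The nonvanishing of pc_dir makes the quotient pc_rho meaningful. The selection
   inequality bounds \<beta> k only from above, so arbitrarily small steps are admitted here. A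
   convergence result must also bound the steps away from 0: for F = id and C = UNIV on the reals,
   with v = 0, \<nu> = 1/2 and \<gamma> = 1, the steps \<beta> k = 1/(k+2)^2 admit
   x k = (k+2)/(k+1), which tends to 1, while 0 is the only solution. *)
definition PC_II_perturbed ::
  "'a::real_inner set \<Rightarrow> ('a \<Rightarrow> 'a) \<Rightarrow> real \<Rightarrow> real \<Rightarrow> (nat \<Rightarrow> real) \<Rightarrow> (nat \<Rightarrow> 'a)
     \<Rightarrow> (nat \<Rightarrow> real) \<Rightarrow> (nat \<Rightarrow> 'a) \<Rightarrow> bool" where
  "PC_II_perturbed C F \<nu> \<gamma> lam v \<beta> x \<longleftrightarrow>
     (\<forall>k. let w = x k + lam k *\<^sub>R v k;
              y = metric_proj C (w - \<beta> k *\<^sub>R F w)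
          in 0 < \<beta> k
           \<and> \<beta> k * norm (F w - F y) \<le> \<nu> * norm (w - y)
           \<and> pc_dir F (\<beta> k) w y \<noteq> 0
           \<and> x (Suc k) = metric_proj C (w - (\<gamma> * \<beta> k * pc_rho F (\<beta> k) w y) *\<^sub>R F y))"

end

theory Submission
  imports Defs
begin

text \<open>
  Write \<open>w\<^sub>k = x\<^sub>k + \<lambda>\<^sub>k v\<^sub>k\<close> for the perturbed iterate and let \<open>p\<close> be a solution.  The
  projection that defines \<open>y\<^sub>k\<close> gives \<open>\<langle>d\<^sub>k, z - y\<^sub>k\<rangle> \<le> \<beta>\<^sub>k \<langle>F y\<^sub>k, z - y\<^sub>k\<rangle>\<close> for \<open>z\<close> in \<open>C\<close>,
  and monotonicity makes the right side nonpositive at \<open>z = p\<close>, while \<open>\<langle>d\<^sub>k, w\<^sub>k - y\<^sub>k\<rangle> > 0\<close>.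
  So the hyperplane through \<open>y\<^sub>k\<close> with normal \<open>d\<^sub>k\<close> separates \<open>w\<^sub>k\<close> from the solutions, and
  \<open>w\<^sub>k - \<rho>\<^sub>k d\<^sub>k\<close> is the projection of \<open>w\<^sub>k\<close> onto it; a relaxation \<open>\<gamma> \<in> (0,2)\<close> of this
  move still comes closer to \<open>p\<close>.  The algorithm moves along \<open>\<beta>\<^sub>k F y\<^sub>k\<close> in place of \<open>d\<^sub>k\<close> and
  then projects onto \<open>C\<close>, and the inequality above transfers the estimate to this move.
  Lemma \<open>pc_step_contracts\<close> makes this quantitative:
  \<open>\<parallel>x\<^sub>k\<^sub>+\<^sub>1 - p\<parallel>\<^sup>2 + c \<parallel>w\<^sub>k - y\<^sub>k\<parallel>\<^sup>2 \<le> \<parallel>w\<^sub>k - p\<parallel>\<^sup>2\<close>, where \<open>c > 0\<close> depends on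
  \<open>\<gamma>\<close> and \<open>\<nu>\<close> only.

  Since \<open>\<parallel>w\<^sub>k - x\<^sub>k\<parallel> = O(\<lambda>\<^sub>k)\<close> is summable, the distances \<open>\<parallel>x\<^sub>k - p\<parallel>\<close> converge
  (\<open>summably_perturbed_decreasing_convergent\<close>), and then the same inequality forces
  \<open>w\<^sub>k - y\<^sub>k \<rightarrow> 0\<close>.  As \<open>y\<^sub>k\<close> is the projection of \<open>w\<^sub>k - \<beta>\<^sub>k F w\<^sub>k\<close> and \<open>\<beta>\<^sub>k\<close> stays away from
  0, the \<open>w\<^sub>k\<close> satisfy the variational inequality up to an error that tends to 0.  Monotonicity
  moves \<open>F\<close> to the test point, so that this passes to weak limits, and
  \<open>minty_variational_inequality\<close> shows that every weak cluster point is a solution.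
  Together with the convergence of the distances, \<open>opial_weak_convergence\<close> yields the theorem.

  Weak cluster points are taken along filters finer than \<open>sequentially\<close>.  Their
  existence then comes from Tychonoff's theorem and Riesz representation, in Hilbert spaces of
  any dimension and without extracting subsequences.
\<close>

section \<open>Minimisation over closed convex sets\<close>

text \<open>
  The point \<open>q\<close> minimises \<open>\<phi> z = \<parallel>z\<parallel>\<^sup>2 - 2 f z\<close> over \<open>C\<close>, and the conclusion is its first-order
  optimality condition.  A minimiser exists because the parallelogram law makes every minimising
  sequence Cauchy.  For \<open>C = UNIV\<close> this is Riesz representation; for \<open>f z = \<langle>a, z\<rangle>\<close> it is
  the existence of the nearest point to \<open>a\<close>.
\<close>

lemma quadratic_minimiser_on_closed_convex:
  fixes C :: "'a::{real_inner, complete_space} set" and f :: "'a \<Rightarrow> real"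
  assumes "C \<noteq> {}" "closed C" "convex C" "bounded_linear f"
  shows "\<exists>q\<in>C. \<forall>z\<in>C. f (z - q) \<le> inner q (z - q)"
proof -
  interpret f: bounded_linear f by fact
  define \<phi> where "\<phi> z = inner z z - 2 * f z" for z
  define m where "m = Inf (\<phi> ` C)"
  obtain K where K: "\<And>z. \<bar>f z\<bar> \<le> norm z * K"
    using f.bounded by auto
  have "- K\<^sup>2 \<le> \<phi> z" for z
  proof -
    have "0 \<le> (norm z - K)\<^sup>2" by simp
    then show ?thesis
      using K[of z] unfolding \<phi>_def by (auto simp: power2_norm_eq_inner[symmetric] power2_diff)
  qed
  then have bdd: "bdd_below (\<phi> ` C)" by (auto simp: bdd_below_def)
  have m_le: "m \<le> \<phi> z" if "z \<in> C" for z
    unfolding m_def using bdd that by (simp add: cInf_lower)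
  \<comment> \<open>the parallelogram law, combined with \<open>\<phi> \<ge> m\<close> at the midpoint\<close>
  have close: "(norm (z - z'))\<^sup>2 \<le> 2 * (\<phi> z - m) + 2 * (\<phi> z' - m)"
    if "z \<in> C" "z' \<in> C" for z z'
  proof -
    let ?w = "(1/2) *\<^sub>R z + (1/2) *\<^sub>R z'"
    have "?w \<in> C" using that \<open>convex C\<close> by (auto intro!: convexD)
    then have "m \<le> \<phi> ?w" by (rule m_le)
    moreover have "(norm (z - z'))\<^sup>2 = 2 * \<phi> z + 2 * \<phi> z' - 4 * \<phi> ?w"
      unfolding \<phi>_def power2_norm_eq_inner
      by (simp add: f.add f.scaleR inner_simps inner_commute algebra_simps)
    ultimately show ?thesis by simp
  qed
  have "\<exists>z\<in>C. \<phi> z < m + 1 / real (Suc n)" for n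
  proof -
    have "Inf (\<phi> ` C) < m + 1 / real (Suc n)" unfolding m_def by simp
    then show ?thesis using cInf_lessD[of "\<phi> ` C"] \<open>C \<noteq> {}\<close> by auto
  qed
  then obtain s where s: "\<And>n. s n \<in> C" "\<And>n. \<phi> (s n) < m + 1 / real (Suc n)"
    by metis
  have "Cauchy s"
  proof (rule metric_CauchyI)
    fix e :: real assume "0 < e"
    then obtain N where N: "1 / real (Suc N) < e\<^sup>2 / 4"
      using reals_Archimedean[of "e\<^sup>2 / 4"] by (auto simp: inverse_eq_divide)
    have small: "\<phi> (s i) - m < e\<^sup>2 / 4" if "N \<le> i" for i
    proof -
      have "\<phi> (s i) < m + 1 / real (Suc i)" by (rule s(2))
      also have "\<dots> \<le> m + 1 / real (Suc N)" using that by (auto simp: field_simps)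
      also have "\<dots> < m + e\<^sup>2 / 4" using N by simp
      finally show ?thesis by simp
    qed
    have "dist (s i) (s j) < e" if "N \<le> i" "N \<le> j" for i j
    proof -
      have "(norm (s i - s j))\<^sup>2 < e\<^sup>2"
        using close[OF s(1) s(1), of i j] small[OF that(1)] small[OF that(2)] by simp
      then show ?thesis
        using \<open>0 < e\<close> by (simp add: dist_norm power_less_imp_less_base)
    qed
    then show "\<exists>M. \<forall>i\<ge>M. \<forall>j\<ge>M. dist (s i) (s j) < e" by blast
  qed
  then obtain q where q: "s \<longlonglongrightarrow> q"
    using Cauchy_convergent convergent_def by blast
  have "q \<in> C" using closed_sequentially[OF \<open>closed C\<close>] s(1) q by blast
  have "(\<lambda>n. \<phi> (s n)) \<longlonglongrightarrow> \<phi> q"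
    unfolding \<phi>_def by (intro tendsto_intros f.tendsto q)
  moreover have "(\<lambda>n. m + 1 / real (Suc n)) \<longlonglongrightarrow> m + 0"
    by (intro tendsto_intros LIMSEQ_Suc[OF lim_1_over_n])
  ultimately have "\<phi> q \<le> m"
    using s(2) by (auto intro: LIMSEQ_le less_imp_le)
  \<comment> \<open>Compare \<open>\<phi> q\<close> with \<open>\<phi>\<close> at a point of the segment from \<open>q\<close> to \<open>z\<close>; the parameter \<open>t\<close> is so
    small that the second-order term costs at most \<open>e\<close>.\<close>
  have "f (z - q) \<le> inner q (z - q)" if "z \<in> C" for z
  proof (rule field_le_epsilon)
    fix e :: real assume "0 < e"
    let ?d = "z - q"
    define t where "t = min 1 (e / (1 + (norm ?d)\<^sup>2))"
    have pos: "0 < 1 + (norm ?d)\<^sup>2" by (simp add: add_pos_nonneg)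
    have "t \<le> e / (1 + (norm ?d)\<^sup>2)" by (simp add: t_def)
    then have "t * (1 + (norm ?d)\<^sup>2) \<le> e" using pos by (simp add: pos_le_divide_eq)
    then have t: "0 < t" "t \<le> 1" "t * (1 + (norm ?d)\<^sup>2) \<le> e"
      using \<open>0 < e\<close> pos by (auto simp: t_def)
    have "q + t *\<^sub>R ?d = (1 - t) *\<^sub>R q + t *\<^sub>R z" by (simp add: algebra_simps)
    then have "q + t *\<^sub>R ?d \<in> C"
      using \<open>convex C\<close> \<open>q \<in> C\<close> that t by (simp add: convexD_alt)
    then have "\<phi> q \<le> \<phi> (q + t *\<^sub>R ?d)" using \<open>\<phi> q \<le> m\<close> m_le by force
    also have "\<phi> (q + t *\<^sub>R ?d) = \<phi> q + t * (2 * inner q ?d + t * (norm ?d)\<^sup>2 - 2 * f ?d)"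
      unfolding \<phi>_def power2_norm_eq_inner f.add f.scaleR inner_add_left inner_add_right
        inner_scaleR_left inner_scaleR_right inner_commute[of ?d q] real_scaleR_def
      by algebra
    finally have "0 \<le> 2 * inner q ?d + t * (norm ?d)\<^sup>2 - 2 * f ?d"
      using \<open>0 < t\<close> by (simp add: zero_le_mult_iff)
    then show "f ?d \<le> inner q ?d + e" using t \<open>0 < e\<close> by (simp add: algebra_simps)
  qed
  then show ?thesis using \<open>q \<in> C\<close> by blast
qed

corollary riesz_representation:
  fixes f :: "'a::{real_inner, complete_space} \<Rightarrow> real"
  assumes "bounded_linear f"
  shows "\<exists>q. \<forall>z. f z = inner q z"
proof -
  interpret f: bounded_linear f by fact
  obtain q where q: "\<And>z. f (z - q) \<le> inner q (z - q)"
    using quadratic_minimiser_on_closed_convex[of UNIV f] assms by auto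
  have "f z \<le> inner q z" for z using q[of "z + q"] by simp
  from this this[of "- z" for z] have "f z = inner q z" for z
    by (simp add: f.neg order_antisym)
  then show ?thesis by blast
qed

lemma metric_proj_nearest:
  fixes C :: "'a::{real_inner, complete_space} set"
  assumes "C \<noteq> {}" "closed C" "convex C"
  shows "metric_proj C a \<in> C" "\<forall>z\<in>C. dist a (metric_proj C a) \<le> dist a z"
proof -
  obtain q where q: "q \<in> C" "\<And>z. z \<in> C \<Longrightarrow> inner a (z - q) \<le> inner q (z - q)"
    using quadratic_minimiser_on_closed_convex[OF assms bounded_linear_inner_right, of a] by blast
  have "dist a q \<le> dist a z" if "z \<in> C" for z
  proof -
    have "(norm (a - z))\<^sup>2 =
        (norm (a - q))\<^sup>2 + (norm (z - q))\<^sup>2 + 2 * (inner q (z - q) - inner a (z - q))"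
      unfolding power2_norm_eq_inner by (simp add: inner_simps inner_commute)
    then have "(norm (a - q))\<^sup>2 \<le> (norm (a - z))\<^sup>2" using q(2)[OF that] by simp
    then show ?thesis unfolding dist_norm by (rule power2_le_imp_le) simp
  qed
  then have "\<exists>p. p \<in> C \<and> (\<forall>z\<in>C. dist a p \<le> dist a z)" using q(1) by blast
  from someI_ex[OF this] show "metric_proj C a \<in> C" "\<forall>z\<in>C. dist a (metric_proj C a) \<le> dist a z"
    unfolding metric_proj_def by blast+
qed

lemma metric_proj_obtuse:
  fixes C :: "'a::{real_inner, complete_space} set"
  assumes "closed C" "convex C" "z \<in> C"
  shows "inner (a - metric_proj C a) (z - metric_proj C a) \<le> 0"
  using any_closest_point_dot[of C "metric_proj C a" z a] metric_proj_nearest[of C a] assms by blast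

section \<open>Weak cluster points and Opial's lemma\<close>

text \<open>
  The functionals \<open>z \<mapsto> \<langle>u\<^sub>i, z\<rangle>\<close> all lie in a product of compact intervals, which is compact by
  Tychonoff's theorem.  A cluster point of them in the product is a pointwise limit along a finer
  filter, hence linear and bounded, hence of the form \<open>\<langle>q, \<cdot>\<rangle>\<close>.
\<close>

lemma weak_cluster_point:
  fixes u :: "'i \<Rightarrow> 'a::{real_inner, complete_space}"
  assumes "bounded (range u)" "H \<noteq> bot"
  shows "\<exists>G q. G \<le> H \<and> G \<noteq> bot \<and> (\<forall>z. ((\<lambda>i. inner (u i) z) \<longlongrightarrow> inner q z) G)"
proof -
  obtain B where B: "\<And>i. norm (u i) \<le> B"
    using assms(1) by (auto simp: bounded_iff)
  define g where "g i z = inner (u i) z" for i z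
  let ?U = "\<Pi>\<^sub>E z\<in>UNIV. {- (B * norm z)..B * norm z}"
  have g_le: "\<bar>g i z\<bar> \<le> B * norm z" for i z
    unfolding g_def using Cauchy_Schwarz_ineq2[of "u i" z] B[of i]
    by (meson mult_right_mono norm_ge_zero order_trans)
  have "compact ?U"
    using compactin_PiE[of "\<lambda>_. euclidean" UNIV "\<lambda>z. {- (B * norm z)..B * norm z}"]
    by (simp add: euclidean_product_topology)
  moreover have "filtermap g H \<noteq> bot"
    using \<open>H \<noteq> bot\<close> by (simp add: filtermap_bot_iff)
  moreover have "g i \<in> ?U" for i
    using g_le[of i] by (auto simp: abs_le_iff minus_le_iff)
  then have "eventually (\<lambda>h. h \<in> ?U) (filtermap g H)"
    by (simp add: eventually_filtermap)
  ultimately obtain f where f: "inf (nhds f) (filtermap g H) \<noteq> bot"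
    unfolding compact_filter by blast
  \<comment> \<open>the coarsest refinement of \<open>H\<close> along which \<open>g\<close> tends to \<open>f\<close>\<close>
  define G where "G = inf H (filtercomap g (nhds f))"
  have "G \<noteq> bot"
  proof
    assume "G = bot"
    then have "eventually (\<lambda>_. False) G" by simp
    then obtain Q R where "eventually Q H" "eventually R (filtercomap g (nhds f))"
        and QR: "\<And>i. Q i \<Longrightarrow> R i \<Longrightarrow> False"
      unfolding G_def eventually_inf by auto
    then obtain R' where R': "eventually R' (nhds f)" "\<And>i. R' (g i) \<Longrightarrow> R i"
      by (auto simp: eventually_filtercomap)
    have "eventually (\<lambda>h. \<not> R' h) (filtermap g H)"
      unfolding eventually_filtermap using \<open>eventually Q H\<close>
      by (rule eventually_mono) (use QR R' in blast)
    with R'(1) have "eventually (\<lambda>_. False) (inf (nhds f) (filtermap g H))"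
      unfolding eventually_inf by blast
    with f show False by simp
  qed
  have "filterlim g (nhds f) G"
    unfolding G_def by (meson filterlim_filtercomap filterlim_mono inf_le2 order_refl)
  have lim: "((\<lambda>i. inner (u i) z) \<longlongrightarrow> f z) G" for z
  proof (rule topological_tendstoI)
    fix S :: "real set" assume "open S" "f z \<in> S"
    have "continuous_on UNIV (\<lambda>h::'a \<Rightarrow> real. h z)" by simp
    then have "open ((\<lambda>h::'a \<Rightarrow> real. h z) -` S)" using \<open>open S\<close> by (intro open_vimage)
    then have "eventually (\<lambda>i. g i \<in> (\<lambda>h. h z) -` S) G"
      using \<open>f z \<in> S\<close> \<open>filterlim g (nhds f) G\<close> by (intro topological_tendstoD) auto
    then show "eventually (\<lambda>i. inner (u i) z \<in> S) G" by (simp add: g_def)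
  qed
  note uniq = tendsto_unique[OF \<open>G \<noteq> bot\<close>]
  have "bounded_linear f"
  proof (rule bounded_linear_intro)
    show "f (y + z) = f y + f z" for y z
      using uniq[OF lim[of "y + z"]] tendsto_add[OF lim[of y] lim[of z]]
      by (simp add: inner_add_right)
    show "f (r *\<^sub>R z) = r *\<^sub>R f z" for r z
      using uniq[OF lim[of "r *\<^sub>R z"]] tendsto_mult_left[OF lim[of z], of r] by simp
    show "norm (f z) \<le> norm z * B" for z
      using tendsto_upperbound[OF tendsto_rabs[OF lim[of z]] _ \<open>G \<noteq> bot\<close>, of "norm z * B"] g_le[of _ z]
      by (simp add: g_def mult.commute)
  qed
  then obtain q where "\<And>z. f z = inner q z" using riesz_representation by blast
  with lim have "((\<lambda>i. inner (u i) z) \<longlongrightarrow> inner q z) G" for z by metis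
  moreover have "G \<le> H" by (simp add: G_def)
  ultimately show ?thesis using \<open>G \<noteq> bot\<close> by blast
qed

text \<open>
  If \<open>q\<close> were outside \<open>C\<close>, the hyperplane through its projection \<open>r\<close> with normal \<open>q - r\<close> would
  separate it from all \<open>u\<^sub>i\<close>.
\<close>

lemma closed_convex_weak_limit:
  fixes C :: "'a::{real_inner, complete_space} set"
  assumes "C \<noteq> {}" "closed C" "convex C" "G \<noteq> bot" "\<And>i. u i \<in> C"
    and lim: "\<And>z. ((\<lambda>i. inner (u i) z) \<longlongrightarrow> inner q z) G"
  shows "q \<in> C"
proof -
  let ?r = "metric_proj C q"
  have "((\<lambda>i. inner (u i) (q - ?r) - inner ?r (q - ?r)) \<longlongrightarrow> inner q (q - ?r) - inner ?r (q - ?r)) G"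
    by (intro tendsto_intros lim)
  moreover have "inner (u i) (q - ?r) - inner ?r (q - ?r) \<le> 0" for i
    using metric_proj_obtuse[of C "u i" q] assms by (simp add: inner_diff_left[symmetric] inner_commute)
  ultimately have "inner q (q - ?r) - inner ?r (q - ?r) \<le> 0"
    by (rule tendsto_upperbound[OF _ always_eventually \<open>G \<noteq> bot\<close>, rule_format])
  then have "inner (q - ?r) (q - ?r) = 0"
    by (intro antisym inner_ge_zero) (simp add: inner_diff_left)
  then have "q = ?r" by simp
  then show ?thesis using metric_proj_nearest(1)[OF assms(1-3)] by metis
qed

text \<open>
  If \<open>p\<close> and \<open>q\<close> are weak cluster points, both lie in \<open>S\<close>, and \<open>\<langle>x\<^sub>k, p - q\<rangle>\<close> converges because
  it is a combination of \<open>\<parallel>x\<^sub>k - p\<parallel>\<^sup>2\<close>, \<open>\<parallel>x\<^sub>k - q\<parallel>\<^sup>2\<close> and constants.  Its limit equals both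
  \<open>\<langle>p, p - q\<rangle>\<close> and \<open>\<langle>q, p - q\<rangle>\<close>, so \<open>p = q\<close>.  A bounded sequence with only one weak
  cluster point converges weakly to it.
\<close>

lemma opial_weak_convergence:
  fixes x :: "nat \<Rightarrow> 'a::{real_inner, complete_space}"
  assumes "S \<noteq> {}"
    and dist_conv: "\<And>p. p \<in> S \<Longrightarrow> convergent (\<lambda>k. norm (x k - p))"
    and cluster: "\<And>G q. G \<le> sequentially \<Longrightarrow> G \<noteq> bot \<Longrightarrow>
       (\<And>z. ((\<lambda>k. inner (x k) z) \<longlongrightarrow> inner q z) G) \<Longrightarrow> q \<in> S"
  shows "\<exists>p\<in>S. weakly_converges_to x p"
proof -
  obtain p0 where "p0 \<in> S" using \<open>S \<noteq> {}\<close> by blast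
  then have "Bseq (\<lambda>k. norm (x k - p0))" using dist_conv convergent_imp_Bseq by blast
  then obtain K where K: "\<And>k. norm (x k - p0) \<le> K" by (auto simp: Bseq_def)
  have "norm (x k) \<le> norm p0 + K" for k
    using norm_triangle_ineq[of "x k - p0" p0] K[of k] by simp
  then have bdd: "bounded (range x)" by (auto simp: bounded_iff)
  have unique: "p = q"
    if G: "G \<le> sequentially" "G \<noteq> bot" "\<And>z. ((\<lambda>k. inner (x k) z) \<longlongrightarrow> inner p z) G"
      and G': "G' \<le> sequentially" "G' \<noteq> bot" "\<And>z. ((\<lambda>k. inner (x k) z) \<longlongrightarrow> inner q z) G'"
    for G G' p q
  proof -
    have "p \<in> S" "q \<in> S" using cluster G G' by blast+
    then obtain a b where a: "(\<lambda>k. norm (x k - p)) \<longlonglongrightarrow> a" and b: "(\<lambda>k. norm (x k - q)) \<longlonglongrightarrow> b"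
      using dist_conv by (meson convergent_def)
    have "inner (x k) (p - q) =
        ((norm (x k - q))\<^sup>2 - (norm (x k - p))\<^sup>2 + inner p p - inner q q) / 2" for k
      unfolding power2_norm_eq_inner by (simp add: inner_simps inner_commute)
    moreover have "(\<lambda>k. ((norm (x k - q))\<^sup>2 - (norm (x k - p))\<^sup>2 + inner p p - inner q q) / 2)
        \<longlonglongrightarrow> (b\<^sup>2 - a\<^sup>2 + inner p p - inner q q) / 2"
      by (intro tendsto_intros a b) auto
    ultimately obtain l where l: "(\<lambda>k. inner (x k) (p - q)) \<longlonglongrightarrow> l" by auto
    have "inner p (p - q) = l"
      using tendsto_unique[OF G(2) G(3)] tendsto_mono[OF G(1) l] by blast
    moreover have "inner q (p - q) = l"
      using tendsto_unique[OF G'(2) G'(3)] tendsto_mono[OF G'(1) l] by blast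
    ultimately have "inner (p - q) (p - q) = 0" by (simp add: inner_diff_left)
    then show "p = q" by simp
  qed
  obtain G p where G: "G \<le> sequentially" "G \<noteq> bot"
      and p: "\<And>z. ((\<lambda>k. inner (x k) z) \<longlongrightarrow> inner p z) G"
    using weak_cluster_point[OF bdd sequentially_bot] by blast
  have "(\<lambda>k. inner (x k) z) \<longlonglongrightarrow> inner p z" for z
  proof (rule ccontr)
    assume "\<not> ?thesis"
    then obtain e where "0 < e"
        and e: "\<not> eventually (\<lambda>k. dist (inner (x k) z) (inner p z) < e) sequentially"
      by (auto simp: tendsto_iff)
    \<comment> \<open>restrict to the indices where \<open>\<langle>x k, z\<rangle>\<close> stays away from \<open>\<langle>p, z\<rangle>\<close>: a cluster point along
      them must be \<open>p\<close> again\<close>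
    define H where
      "H = inf sequentially (principal {k. \<not> dist (inner (x k) z) (inner p z) < e})"
    have "H \<noteq> bot"
      using e unfolding H_def trivial_limit_def eventually_inf_principal by simp
    then obtain G' q where G': "G' \<le> H" "G' \<noteq> bot"
        and q: "\<And>z. ((\<lambda>k. inner (x k) z) \<longlongrightarrow> inner q z) G'"
      using weak_cluster_point[OF bdd] by blast
    have "G' \<le> sequentially" using G'(1) by (simp add: H_def)
    then have "p = q" using unique[OF G p _ G'(2) q] by blast
    then have "eventually (\<lambda>k. dist (inner (x k) z) (inner p z) < e) G'"
      using q \<open>0 < e\<close> by (auto simp: tendsto_iff)
    moreover have "eventually (\<lambda>k. \<not> dist (inner (x k) z) (inner p z) < e) G'"
      using G'(1) unfolding H_def by (auto simp: le_inf_iff le_principal)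
    ultimately have "eventually (\<lambda>_. False) G'" by eventually_elim blast
    with G'(2) show False by simp
  qed
  then have "weakly_converges_to x p" by (simp add: weakly_converges_to_def)
  moreover have "p \<in> S" using cluster G p by blast
  ultimately show ?thesis by blast
qed

section \<open>Perturbed monotone sequences\<close>

lemma summably_perturbed_decreasing_convergent:
  fixes a e :: "nat \<Rightarrow> real"
  assumes "\<And>k. 0 \<le> a k" "\<And>k. 0 \<le> e k" "summable e" "\<And>k. a (Suc k) \<le> a k + e k"
  shows "convergent a"
proof -
  \<comment> \<open>subtracting the accumulated errors leaves a decreasing sequence\<close>
  define b where "b k = a k - (\<Sum>i<k. e i)" for k
  have "decseq b" using assms(4) by (auto simp: b_def decseq_Suc_iff algebra_simps)
  moreover have "- suminf e \<le> b k" for k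
    using sum_le_suminf[OF assms(3), of "{..<k}"] assms(1)[of k] assms(2) by (simp add: b_def)
  ultimately have "convergent b" by (metis convergent_def decseq_convergent)
  moreover have "convergent (\<lambda>k. \<Sum>i<k. e i)"
    using assms(3) by (simp add: summable_iff_convergent)
  ultimately have "convergent (\<lambda>k. b k + (\<Sum>i<k. e i))" by (rule convergent_add)
  then show ?thesis by (simp add: b_def)
qed

section \<open>Monotone variational inequalities and the step of the algorithm\<close>

text \<open>
  Test the hypothesis at points \<open>q + t (z - q)\<close> of \<open>C\<close>, divide by \<open>t\<close>, and let \<open>t\<close> tend to 0.  The
  hypothesis is affine in \<open>q\<close>, unlike membership in \<open>VI_SOL\<close>, and so it survives weak limits.
\<close>

lemma minty_variational_inequality:
  assumes "convex C" "q \<in> C" "continuous_on UNIV F" "\<And>z. z \<in> C \<Longrightarrow> 0 \<le> inner (F z) (z - q)"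
  shows "q \<in> VI_SOL C F"
proof -
  have "0 \<le> inner (F q) (z - q)" if "z \<in> C" for z
  proof -
    define t where "t n = 1 / real (Suc n)" for n
    have t: "0 < t n" "t n \<le> 1" for n by (auto simp: t_def)
    have "0 \<le> inner (F (q + t n *\<^sub>R (z - q))) (z - q)" for n
    proof -
      have "q + t n *\<^sub>R (z - q) = (1 - t n) *\<^sub>R q + t n *\<^sub>R z" by (simp add: algebra_simps)
      then have "q + t n *\<^sub>R (z - q) \<in> C"
        using \<open>convex C\<close> \<open>q \<in> C\<close> that t[of n] by (simp add: convexD_alt)
      from assms(4)[OF this] show ?thesis using t[of n] by (simp add: zero_le_mult_iff)
    qed
    moreover have "t \<longlonglongrightarrow> 0" unfolding t_def by (rule LIMSEQ_Suc[OF lim_1_over_n])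
    then have "(\<lambda>n. q + t n *\<^sub>R (z - q)) \<longlonglongrightarrow> q + 0 *\<^sub>R (z - q)" by (intro tendsto_intros)
    then have "(\<lambda>n. F (q + t n *\<^sub>R (z - q))) \<longlonglongrightarrow> F q"
      using continuous_on_tendsto_compose[OF assms(3)] by simp
    then have "(\<lambda>n. inner (F (q + t n *\<^sub>R (z - q))) (z - q)) \<longlonglongrightarrow> inner (F q) (z - q)"
      by (intro tendsto_intros)
    ultimately show ?thesis by (meson LIMSEQ_le_const)
  qed
  then show ?thesis using \<open>q \<in> C\<close> by (simp add: VI_SOL_def)
qed

text \<open>
  The selection rule for the step size says that \<open>d\<close> differs from \<open>w - y\<close> by at most
  \<open>\<nu> \<parallel>w - y\<parallel>\<close>.  The two bounds give \<open>\<rho> \<parallel>d\<parallel> \<ge> (1 - \<nu>) / (1 + \<nu>) \<parallel>w - y\<parallel>\<close>.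
\<close>

lemma pc_dir_bounds:
  assumes "b > 0" "b * norm (F w - F y) \<le> \<nu> * norm (w - y)"
  shows "(1 - \<nu>) * (norm (w - y))\<^sup>2 \<le> inner (w - y) (pc_dir F b w y)"
    and "norm (pc_dir F b w y) \<le> (1 + \<nu>) * norm (w - y)"
proof -
  let ?h = "b *\<^sub>R (F w - F y)"
  have h: "norm ?h \<le> \<nu> * norm (w - y)" using assms by simp
  have "inner (w - y) ?h \<le> norm (w - y) * norm ?h" by (rule norm_cauchy_schwarz)
  also have "\<dots> \<le> norm (w - y) * (\<nu> * norm (w - y))" using h by (intro mult_left_mono) auto
  finally have "inner (w - y) ?h \<le> \<nu> * (norm (w - y))\<^sup>2" by (simp add: power2_eq_square mult.left_commute)
  then show "(1 - \<nu>) * (norm (w - y))\<^sup>2 \<le> inner (w - y) (pc_dir F b w y)"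
    by (simp add: pc_dir_def inner_diff_right[of _ _ ?h] power2_norm_eq_inner left_diff_distrib)
  show "norm (pc_dir F b w y) \<le> (1 + \<nu>) * norm (w - y)"
    using norm_triangle_ineq4[of "w - y" ?h] h by (simp add: pc_dir_def distrib_right)
qed

text \<open>
  The projection that defines \<open>y\<close> and the inequality \<open>\<langle>F y, y - p\<rangle> \<ge> 0\<close> bound \<open>b \<langle>F y, u - p\<rangle>\<close>
  below by \<open>\<langle>d, u - y\<rangle>\<close>.  Inserted into the projection inequality for \<open>u\<close>, this gives
  \<open>\<parallel>u - p\<parallel>\<^sup>2 \<le> \<parallel>w - p\<parallel>\<^sup>2 - \<parallel>w - u\<parallel>\<^sup>2 - 2 \<gamma> \<rho> \<langle>d, u - y\<rangle>\<close>.  By the choice of \<open>\<rho>\<close>,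
  completing the square in \<open>w - u - \<gamma> \<rho> d\<close> turns the last two terms into at most
  \<open>- \<gamma> (2 - \<gamma>) \<rho>\<^sup>2 \<parallel>d\<parallel>\<^sup>2\<close>.  This bound does not involve the step size \<open>b\<close>, so
  that the constant is the same in every iteration.
\<close>

lemma pc_step_contracts:
  fixes C :: "'a::{real_inner, complete_space} set"
  assumes C: "closed C" "convex C" and "monotone_operator F" and "p \<in> VI_SOL C F"
    and "0 < b" "0 < \<nu>" "\<nu> < 1" "0 < \<gamma>" "\<gamma> < 2"
    and y: "y = metric_proj C (w - b *\<^sub>R F w)"
    and rule: "b * norm (F w - F y) \<le> \<nu> * norm (w - y)"
    and d: "pc_dir F b w y \<noteq> 0"
    and u: "u = metric_proj C (w - (\<gamma> * b * pc_rho F b w y) *\<^sub>R F y)"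
  shows "(norm (u - p))\<^sup>2 + \<gamma> * (2 - \<gamma>) * ((1 - \<nu>) / (1 + \<nu>))\<^sup>2 * (norm (w - y))\<^sup>2
           \<le> (norm (w - p))\<^sup>2"
proof -
  define d where "d = pc_dir F b w y"
  define r where "r = pc_rho F b w y"
  have p: "p \<in> C" "\<And>z. z \<in> C \<Longrightarrow> 0 \<le> inner (F p) (z - p)"
    using assms(4) by (auto simp: VI_SOL_def)
  then have "C \<noteq> {}" by blast
  then have uy: "u \<in> C" "y \<in> C" using metric_proj_nearest(1) C unfolding u y by blast+
  have "0 < norm d" using \<open>pc_dir F b w y \<noteq> 0\<close> by (simp add: d_def)
  have rd: "r * (norm d)\<^sup>2 = inner (w - y) d"
    using \<open>0 < norm d\<close> by (simp add: r_def pc_rho_def d_def)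
  note bounds = pc_dir_bounds[OF \<open>0 < b\<close> rule, folded d_def]
  have "0 \<le> inner (w - y) d"
    using bounds(1) \<open>\<nu> < 1\<close> by (meson diff_ge_0_iff_ge less_imp_le mult_nonneg_nonneg order_trans zero_le_power2)
  then have "0 \<le> r" using rd \<open>0 < norm d\<close> by (metis zero_le_mult_iff zero_less_power less_le_not_le)
  have Fy: "0 \<le> inner (F y) (y - p)"
  proof -
    have "0 \<le> inner (F y - F p) (y - p)" using assms(3) by (simp add: monotone_operator_def)
    then show ?thesis using p(2)[OF uy(2)] by (simp add: inner_diff_left)
  qed
  have "inner (w - b *\<^sub>R F w - y) (u - y) \<le> 0"
    unfolding y using metric_proj_obtuse C uy(1) by blast
  also have "w - b *\<^sub>R F w - y = d - b *\<^sub>R F y" by (simp add: d_def pc_dir_def algebra_simps)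
  finally have "inner d (u - y) \<le> b * inner (F y) (u - y)"
    by (simp add: inner_diff_left)
  also have "\<dots> \<le> b * inner (F y) (u - p)"
    using Fy \<open>0 < b\<close> by (simp add: inner_diff_right)
  finally have "(\<gamma> * r) * inner d (u - y) \<le> (\<gamma> * r) * (b * inner (F y) (u - p))"
    using \<open>0 < \<gamma>\<close> \<open>0 \<le> r\<close> by (simp add: mult_left_mono)
  moreover have "inner (w - (\<gamma> * b * r) *\<^sub>R F y - u) (p - u) \<le> 0"
    unfolding u r_def using metric_proj_obtuse C p(1) by blast
  then have "inner (w - u) (p - u) \<le> - (\<gamma> * r) * (b * inner (F y) (u - p))"
    by (simp add: inner_simps algebra_simps)
  ultimately have key: "inner (w - u) (p - u) \<le> - (\<gamma> * r) * inner d (u - y)"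
    unfolding mult_minus_left by (rule order_trans[OF _ le_imp_neg_le, rotated])
  have "(norm (w - p))\<^sup>2 = (norm (u - p))\<^sup>2 + (norm (w - u))\<^sup>2 - 2 * inner (w - u) (p - u)"
    unfolding power2_norm_eq_inner by (simp add: inner_simps inner_commute)
  also have "\<dots> \<ge> (norm (u - p))\<^sup>2 + (norm (w - u))\<^sup>2 + 2 * (\<gamma> * r) * inner d (u - y)"
    using key by simp
  finally have 1: "(norm (u - p))\<^sup>2 + (norm (w - u))\<^sup>2 + 2 * (\<gamma> * r) * inner d (u - y)
      \<le> (norm (w - p))\<^sup>2" .
  \<comment> \<open>completing the square\<close>
  have "0 \<le> (norm (w - u - (\<gamma> * r) *\<^sub>R d))\<^sup>2" by simp
  also have "\<dots> = (norm (w - u))\<^sup>2 - 2 * (\<gamma> * r) * inner d (w - u) + (\<gamma> * r)\<^sup>2 * (norm d)\<^sup>2"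
    unfolding power2_norm_eq_inner by (simp add: inner_simps inner_commute power2_eq_square algebra_simps)
  also have "inner d (w - u) = r * (norm d)\<^sup>2 - inner d (u - y)"
    unfolding rd by (simp add: inner_simps inner_commute)
  finally have 2: "\<gamma> * (2 - \<gamma>) * (r * norm d)\<^sup>2
      \<le> (norm (w - u))\<^sup>2 + 2 * (\<gamma> * r) * inner d (u - y)"
    by (simp add: power2_eq_square algebra_simps)
  have "(1 - \<nu>) / (1 + \<nu>) * norm (w - y) \<le> r * norm d"
  proof -
    have "(1 - \<nu>) * norm (w - y) * norm d \<le> (1 - \<nu>) * norm (w - y) * ((1 + \<nu>) * norm (w - y))"
      using bounds(2) \<open>\<nu> < 1\<close> by (intro mult_left_mono) auto
    also have "\<dots> = (1 + \<nu>) * ((1 - \<nu>) * (norm (w - y))\<^sup>2)" by (simp add: power2_eq_square)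
    also have "\<dots> \<le> (1 + \<nu>) * (r * (norm d)\<^sup>2)"
      unfolding rd using bounds(1) \<open>0 < \<nu>\<close> by (intro mult_left_mono) auto
    also have "\<dots> = (1 + \<nu>) * (r * norm d) * norm d" by (simp add: power2_eq_square)
    finally have "(1 - \<nu>) * norm (w - y) \<le> (1 + \<nu>) * (r * norm d)"
      using \<open>0 < norm d\<close> by simp
    then show ?thesis using \<open>0 < \<nu>\<close> by (simp add: field_simps)
  qed
  then have "((1 - \<nu>) / (1 + \<nu>) * norm (w - y))\<^sup>2 \<le> (r * norm d)\<^sup>2"
    using \<open>0 < \<nu>\<close> \<open>\<nu> < 1\<close> by (intro power_mono) auto
  then have "\<gamma> * (2 - \<gamma>) * ((1 - \<nu>) / (1 + \<nu>) * norm (w - y))\<^sup>2 \<le> \<gamma> * (2 - \<gamma>) * (r * norm d)\<^sup>2"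
    using \<open>0 < \<gamma>\<close> \<open>\<gamma> < 2\<close> by (intro mult_left_mono) auto
  with 1 2 show ?thesis unfolding power_mult_distrib mult.assoc by linarith
qed

section \<open>Weak convergence of the perturbed algorithm\<close>

theorem theorem4p7:
  fixes C :: "'a::{real_inner, complete_space} set"
    and F :: "'a \<Rightarrow> 'a"
    and L \<nu> \<gamma> :: real
    and lam \<beta> :: "nat \<Rightarrow> real"
    and v x :: "nat \<Rightarrow> 'a"
  assumes "C \<noteq> {}" and "closed C" and "convex C"
    and "VI_SOL C F \<noteq> {}"
    and "monotone_operator F"
    and "L > 0" and "L-lipschitz_on UNIV F"
    and "0 < \<nu>" and "\<nu> < 1"
    and "0 < \<gamma>" and "\<gamma> < 2"
    and "bounded (range v)"
    and "\<And>k. 0 < lam k" and "summable lam"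
    and "PC_II_perturbed C F \<nu> \<gamma> lam v \<beta> x"
    and "\<exists>b>0. \<forall>k. b \<le> \<beta> k"
  shows "\<exists>p \<in> VI_SOL C F. weakly_converges_to x p"
proof -
  define w where "w k = x k + lam k *\<^sub>R v k" for k
  define y where "y k = metric_proj C (w k - \<beta> k *\<^sub>R F (w k))" for k
  have alg: "0 < \<beta> k" "\<beta> k * norm (F (w k) - F (y k)) \<le> \<nu> * norm (w k - y k)"
      "pc_dir F (\<beta> k) (w k) (y k) \<noteq> 0"
      "x (Suc k) = metric_proj C (w k - (\<gamma> * \<beta> k * pc_rho F (\<beta> k) (w k) (y k)) *\<^sub>R F (y k))" for k
    using \<open>PC_II_perturbed C F \<nu> \<gamma> lam v \<beta> x\<close>
    unfolding PC_II_perturbed_def Let_def w_def y_def by blast+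
  obtain b where b: "0 < b" "\<And>k. b \<le> \<beta> k" using \<open>\<exists>b>0. \<forall>k. b \<le> \<beta> k\<close> by blast
  obtain M where M: "\<And>k. norm (v k) \<le> M" using \<open>bounded (range v)\<close> by (auto simp: bounded_iff)
  have M0: "0 \<le> M" using M[of 0] norm_ge_zero order_trans by blast
  note lam = \<open>\<And>k. 0 < lam k\<close>
  have y_in: "y k \<in> C" for k
    using metric_proj_nearest(1) \<open>C \<noteq> {}\<close> \<open>closed C\<close> \<open>convex C\<close> unfolding y_def by blast
  define c where "c = \<gamma> * (2 - \<gamma>) * ((1 - \<nu>) / (1 + \<nu>))\<^sup>2"
  have "0 < c" using \<open>0 < \<nu>\<close> \<open>\<nu> < 1\<close> \<open>0 < \<gamma>\<close> \<open>\<gamma> < 2\<close> by (simp add: c_def)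
  have step: "(norm (x (Suc k) - p))\<^sup>2 + c * (norm (w k - y k))\<^sup>2 \<le> (norm (w k - p))\<^sup>2"
    if "p \<in> VI_SOL C F" for p k
    unfolding c_def
    by (rule pc_step_contracts[OF \<open>closed C\<close> \<open>convex C\<close> \<open>monotone_operator F\<close> that alg(1)
          \<open>0 < \<nu>\<close> \<open>\<nu> < 1\<close> \<open>0 < \<gamma>\<close> \<open>\<gamma> < 2\<close> y_def alg(2-4)])
  have wx: "norm (w k - x k) \<le> lam k * M" for k
    using M[of k] lam[of k] by (simp add: w_def mult_left_mono)
  have pert: "norm (w k - p) \<le> norm (x k - p) + lam k * M" for p k
    using norm_triangle_ineq[of "w k - x k" "x k - p"] wx[of k] by simp
  have dist_conv: "convergent (\<lambda>k. norm (x k - p))" if "p \<in> VI_SOL C F" for p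
  proof (rule summably_perturbed_decreasing_convergent)
    show "summable (\<lambda>k. lam k * M)" using \<open>summable lam\<close> by (rule summable_mult2)
    show "0 \<le> lam k * M" for k using lam[of k] M0 by simp
    show "norm (x (Suc k) - p) \<le> norm (x k - p) + lam k * M" for k
    proof -
      have "(norm (x (Suc k) - p))\<^sup>2 \<le> (norm (w k - p))\<^sup>2"
        using step[OF that, of k] \<open>0 < c\<close>
        by (smt (verit) mult_nonneg_nonneg zero_le_power2)
      then have "norm (x (Suc k) - p) \<le> norm (w k - p)" by (rule power2_le_imp_le) simp
      also note pert
      finally show ?thesis .
    qed
  qed simp
  have "lam \<longlonglongrightarrow> 0" using \<open>summable lam\<close> by (rule summable_LIMSEQ_zero)
  then have lamM: "(\<lambda>k. lam k * M) \<longlonglongrightarrow> 0" by (rule tendsto_mult_left_zero)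
  have wx0: "(\<lambda>k. w k - x k) \<longlonglongrightarrow> 0"
    by (rule tendsto_norm_zero_cancel, rule Lim_null_comparison[OF _ lamM]) (use wx in simp)
  obtain p0 where p0: "p0 \<in> VI_SOL C F" using \<open>VI_SOL C F \<noteq> {}\<close> by blast
  obtain l where l: "(\<lambda>k. norm (x k - p0)) \<longlonglongrightarrow> l" using dist_conv[OF p0] by (auto simp: convergent_def)
  have wy0: "(\<lambda>k. w k - y k) \<longlonglongrightarrow> 0"
  proof -
    let ?D = "\<lambda>k. ((norm (x k - p0) + lam k * M)\<^sup>2 - (norm (x (Suc k) - p0))\<^sup>2) / c"
    have "?D \<longlonglongrightarrow> ((l + 0)\<^sup>2 - l\<^sup>2) / c"
      using \<open>0 < c\<close> by (intro tendsto_intros l lamM LIMSEQ_Suc[OF l]) auto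
    then have D: "?D \<longlonglongrightarrow> 0" by simp
    have "(norm (w k - y k))\<^sup>2 \<le> ?D k" for k
    proof -
      have "(norm (w k - p0))\<^sup>2 \<le> (norm (x k - p0) + lam k * M)\<^sup>2"
        using pert[of k p0] by (intro power_mono) auto
      then show ?thesis using step[OF p0, of k] \<open>0 < c\<close> by (simp add: field_simps)
    qed
    then have "(\<lambda>k. (norm (w k - y k))\<^sup>2) \<longlonglongrightarrow> 0"
      by (intro Lim_null_comparison[OF _ D]) simp
    then show ?thesis by (simp add: tendsto_norm_zero_iff)
  qed
  have contF: "continuous_on UNIV F" using \<open>L-lipschitz_on UNIV F\<close> by (rule lipschitz_on_continuous_on)
  have "convergent (\<lambda>k. norm (x k - p0) + lam k * M)"
    using tendsto_add[OF l lamM] by (rule convergentI)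
  then have "Bseq (\<lambda>k. norm (x k - p0) + lam k * M)" by (rule convergent_imp_Bseq)
  then obtain K where K: "\<And>k. \<bar>norm (x k - p0) + lam k * M\<bar> \<le> K" by (auto simp: Bseq_def)
  define R where "R = K + norm p0"
  have R: "norm (w k) \<le> R" for k
    using norm_triangle_ineq[of "w k - p0" p0] pert[of k p0] K[of k] by (simp add: R_def)
  have Fw: "norm (F (w k)) \<le> norm (F 0) + L * R" for k
  proof -
    have "norm (F (w k) - F 0) \<le> L * norm (w k)"
      using lipschitz_onD[OF \<open>L-lipschitz_on UNIV F\<close>, of "w k" 0] by (simp add: dist_norm)
    also have "\<dots> \<le> L * R" using R \<open>L > 0\<close> by simp
    finally show ?thesis using norm_triangle_ineq[of "F (w k) - F 0" "F 0"] by simp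
  qed
  \<comment> \<open>Up to an error that vanishes with \<open>w k - y k\<close>, the \<open>w k\<close> solve Minty's form of the problem.  The
    lower bound \<open>b\<close> on the step sizes keeps the division by \<open>\<beta> k\<close> under control.\<close>
  have approx: "norm (w k - y k) * (norm (F 0) + L * R + (norm z + R + norm (w k - y k)) / b)
      \<ge> - inner (F z) (z - w k)" if "z \<in> C" for z k
  proof -
    let ?n = "norm (w k - y k)"
    have "inner (w k - \<beta> k *\<^sub>R F (w k) - y k) (z - y k) \<le> 0"
      unfolding y_def using metric_proj_obtuse \<open>closed C\<close> \<open>convex C\<close> that by blast
    then have "\<beta> k * - inner (F (w k)) (z - y k) \<le> - inner (w k - y k) (z - y k)"
      by (simp add: inner_simps algebra_simps)
    also have "\<dots> \<le> ?n * norm (z - y k)"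
      using Cauchy_Schwarz_ineq2[of "w k - y k" "z - y k"] by linarith
    finally have "- inner (F (w k)) (z - y k) \<le> ?n * norm (z - y k) / \<beta> k"
      using alg(1)[of k] by (simp add: field_simps)
    also have "\<dots> \<le> ?n * norm (z - y k) / b"
      using b alg(1)[of k] by (intro divide_left_mono) auto
    also have "\<dots> \<le> ?n * (norm z + R + ?n) / b"
    proof -
      have "norm (z - y k) \<le> norm z + norm (w k) + ?n"
        using norm_triangle_ineq[of "z - w k" "w k - y k"] norm_triangle_ineq4[of z "w k"] by simp
      then show ?thesis using R[of k] b by (intro divide_right_mono mult_left_mono) auto
    qed
    finally have 1: "- inner (F (w k)) (z - y k) \<le> ?n * (norm z + R + ?n) / b" .
    have "inner (F (w k)) (w k - y k) \<le> norm (F (w k)) * ?n" by (rule norm_cauchy_schwarz)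
    also have "\<dots> \<le> (norm (F 0) + L * R) * ?n" using Fw by (intro mult_right_mono) auto
    finally have 2: "inner (F (w k)) (w k - y k) \<le> (norm (F 0) + L * R) * ?n" .
    have "0 \<le> inner (F z - F (w k)) (z - w k)"
      using \<open>monotone_operator F\<close> by (simp add: monotone_operator_def)
    then have "- inner (F z) (z - w k) \<le> - inner (F (w k)) (z - y k) + inner (F (w k)) (w k - y k)"
      by (simp add: inner_simps)
    with 1 2 show ?thesis by (simp add: algebra_simps add_divide_distrib)
  qed
  show ?thesis
  proof (rule opial_weak_convergence[OF \<open>VI_SOL C F \<noteq> {}\<close> dist_conv])
    fix G q
    assume G: "G \<le> sequentially" "G \<noteq> bot"
      and xq: "\<And>z. ((\<lambda>k. inner (x k) z) \<longlongrightarrow> inner q z) G"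
    have lim_w: "((\<lambda>k. inner (w k) z) \<longlongrightarrow> inner q z) G" for z
      using tendsto_add[OF xq tendsto_inner[OF tendsto_mono[OF G(1) wx0] tendsto_const], of z z]
      by (simp add: inner_diff_left)
    have lim_y: "((\<lambda>k. inner (y k) z) \<longlongrightarrow> inner q z) G" for z
      using tendsto_diff[OF lim_w tendsto_inner[OF tendsto_mono[OF G(1) wy0] tendsto_const], of z z]
      by (simp add: inner_diff_left)
    have "q \<in> C"
      using closed_convex_weak_limit[OF \<open>C \<noteq> {}\<close> \<open>closed C\<close> \<open>convex C\<close> G(2) y_in lim_y] .
    show "q \<in> VI_SOL C F"
    proof (rule minty_variational_inequality[OF \<open>convex C\<close> \<open>q \<in> C\<close> contF])
      fix z assume "z \<in> C"
      have n0: "((\<lambda>k. norm (w k - y k)) \<longlongrightarrow> 0) G"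
        using tendsto_mono[OF G(1) wy0] by (rule tendsto_norm_zero)
      have "((\<lambda>k. norm (w k - y k) * (norm (F 0) + L * R + (norm z + R + norm (w k - y k)) / b))
          \<longlongrightarrow> 0 * (norm (F 0) + L * R + (norm z + R + 0) / b)) G"
        using b by (intro tendsto_intros n0) auto
      moreover have "((\<lambda>k. inner (w k) (F z) - inner (F z) z) \<longlongrightarrow> inner q (F z) - inner (F z) z) G"
        by (intro tendsto_intros lim_w)
      moreover have "inner (w k) (F z) - inner (F z) z
          \<le> norm (w k - y k) * (norm (F 0) + L * R + (norm z + R + norm (w k - y k)) / b)" for k
        using approx[OF \<open>z \<in> C\<close>, of k] by (simp add: inner_diff_right inner_commute)
      ultimately have "inner q (F z) - inner (F z) z \<le> 0"
        using tendsto_le[OF G(2)] by fastforce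
      then show "0 \<le> inner (F z) (z - q)" by (simp add: inner_diff_right inner_commute)
    qed
  qed
qed

end
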